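(* Let $K$ be a field, $\lambda\in K$. Let $(A,\mu,1,\alpha_A,\beta_A,\psi_A,\omega_A,r)$ be a quasitriangular unitary $\lambda$-infBH-bialgebra and let $(M,\triangleleft,\alpha_M,\beta_M)$ be a right $(A,\mu,\alpha_A,\beta_A)$-module, with $\alpha_M$ invertible. Let $\psi_M,\omega_M:M\to M$ be linear maps such that $\alpha_M\omega_M=\omega_M\alpha_M$ and $\omega_M(m\triangleleft a)=\omega_M(m)\triangleleft\omega_A(a)$ for $a\in A$, $m\in M$. Then $(M,\triangleleft,\varphi,\alpha_M,\beta_M,\psi_M,\omega_M)$ is a right $\lambda$-infBH-Hopf module over $A$ (with comultiplication $\Delta_r$), where the coaction $\varphi:M\to M\otimes A$ is given by $$\varphi(m)=\omega_M\alpha_M^{-1}(m)\triangleleft r^1\otimes\beta_A(r^2)-\lambda\,\omega_M(m)\otimes1,\qquad m\in M.$$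
   Context: Everything is over the field $K$. BiHom-associative algebra $(A,\mu,\alpha,\beta)$: $\mu$ (written $ab$) and $\alpha,\beta$ linear, $\alpha\beta=\beta\alpha$, $\alpha,\beta$ multiplicative, $\alpha(a)(bc)=(ab)\beta(c)$. Unitary: there is $1\in A$ with $\alpha(1)=\beta(1)=1$, $a1=\alpha(a)$, $1a=\beta(a)$. Quasitriangular unitary $\lambda$-infBH-bialgebra ($\lambda$-infinitesimal BiHom-bialgebra) $(A,\mu,1,\alpha,\beta,\psi,\omega,r)$: $(A,\mu,1,\alpha,\beta)$ is a unitary BiHom-associative algebra with $\alpha,\beta$ bijective; $\psi,\omega:A\to A$ are linear, multiplicative, each commutes with $\alpha$ and with $\beta$, and $\psi(1)=\omega(1)=1$; $r=r^1\otimes r^2\in A\otimes A$ (summation understood) is invariant under $f\otimes f$ for $f\in\{\alpha,\beta,\psi,\omega\}$; and, with $\bar r$ a second copy of $r$, $$\omega(r^1)\bar r^1\otimes\beta(\bar r^2)\otimes\alpha\psi(r^2)-\alpha(r^1)\otimes r^2\bar r^1\otimes\beta(\bar r^2)+\beta\omega(r^1)\otimes\alpha(\bar r^1)\otimes\bar r^2\psi(r^2)=\lambda\,\omega(r^1)\otimes1\otimes\psi(r^2).$$ Its comultiplication is $\Delta_r(a)=\omega\alpha^{-1}(a)r^1\otimes\beta(r^2)-\alpha(r^1)\otimes r^2\psi\beta^{-1}(a)-\lambda\,\omega(a)\otimes1$. Right module $(M,\triangleleft,\alpha_M,\beta_M)$: $\alpha_M\beta_M=\beta_M\alpha_M$;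 $f_M(m\triangleleft a)=f_M(m)\triangleleft f_A(a)$ for $f\in\{\alpha,\beta\}$; $\alpha_M(m)\triangleleft(aa')=(m\triangleleft a)\triangleleft\beta_A(a')$. Right comodule $(M,\varphi,\psi_M,\omega_M)$ over $(A,\Delta,\psi_A,\omega_A)$: $\psi_M\omega_M=\omega_M\psi_M$; $(g_M\otimes g_A)\varphi=\varphi g_M$ for $g\in\{\psi,\omega\}$; $(\omega_M\otimes\Delta)\varphi=(\varphi\otimes\psi_A)\varphi$. Right $\lambda$-infBH-Hopf module $(M,\triangleleft,\varphi,\alpha_M,\beta_M,\psi_M,\omega_M)$: a right module and a right comodule, any two of $\alpha_M,\beta_M,\psi_M,\omega_M$ commute, and, with $\varphi(m)=m_{(0)}\otimes m_{(1)}$, $\Delta(a)=a_1\otimes a_2$, $\varphi(m\triangleleft a)=\omega_M(m)\triangleleft a_1\otimes\beta_A(a_2)+\alpha_M(m_{(0)})\otimes m_{(1)}\psi_A(a)+\lambda\,\alpha_M\omega_M(m)\otimes\beta_A\psi_A(a)$.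
   Formalization: As stated the claim fails (ψ_M, ω_M need not commute), so it is also assumed that β_M commutes with ω_M, that ψ_M commutes with α_M, β_M and ω_M, and that ψ_M(m◁a)=ψ_M(m)◁ψ_A(a) for all m in M, a in A. *)

theory Defs
  imports Complex_Main "HOL-Library.Poly_Mapping"
begin

section \<open>Free vector spaces and tensor products\<close>

definition fscale :: "'k::field \<Rightarrow> ('x \<Rightarrow>\<^sub>0 'k) \<Rightarrow> ('x \<Rightarrow>\<^sub>0 'k)" (infixr \<open>\<bullet>\<close> 75)
  where "c \<bullet> s = Poly_Mapping.map ((*) c) s"

lemma lookup_fscale [simp]: "Poly_Mapping.lookup (c \<bullet> s) x = c * Poly_Mapping.lookup s x"
  by (simp add: fscale_def Poly_Mapping.map.rep_eq when_def)

interpretation free: vector_space "fscale :: 'k::field \<Rightarrow> ('x \<Rightarrow>\<^sub>0 'k) \<Rightarrow> ('x \<Rightarrow>\<^sub>0 'k)"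
  by unfold_locales (rule poly_mapping_eqI, simp add: Poly_Mapping.lookup_add algebra_simps)+

text \<open>
  The tensor product of \<open>K\<close>-vector spaces \<open>V\<close>, \<open>W\<close> is the quotient of the free vector space on
  \<open>V \<times> W\<close> by the subspace spanned by the bilinearity relators, and \<open>U \<otimes> V \<otimes> W\<close> is likewise
  the quotient of the free vector space on \<open>U \<times> V \<times> W\<close> by the trilinearity relators. A type
  cannot depend on the scalar multiplications, so tensors are written as elements of the free
  vector space, and equality of tensors is congruence modulo the relators.
\<close>

abbreviation ten2 :: "'v \<Rightarrow> 'w \<Rightarrow> ('v \<times> 'w \<Rightarrow>\<^sub>0 'k::field)"
  where "ten2 v w \<equiv> Poly_Mapping.single (v, w) 1"

abbreviation ten3 :: "'u \<Rightarrow> 'v \<Rightarrow> 'w \<Rightarrow> ('u \<times> 'v \<times> 'w \<Rightarrow>\<^sub>0 'k::field)"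
  where "ten3 u v w \<equiv> Poly_Mapping.single (u, v, w) 1"

definition rel2 :: "('k::field \<Rightarrow> 'v::ab_group_add \<Rightarrow> 'v) \<Rightarrow> ('k \<Rightarrow> 'w::ab_group_add \<Rightarrow> 'w)
    \<Rightarrow> ('v \<times> 'w \<Rightarrow>\<^sub>0 'k) set"
  where "rel2 sV sW =
      {ten2 (v + v') w - ten2 v w - ten2 v' w | v v' w. True}
    \<union> {ten2 v (w + w') - ten2 v w - ten2 v w' | v w w'. True}
    \<union> {ten2 (sV c v) w - c \<bullet> ten2 v w | c v w. True}
    \<union> {ten2 v (sW c w) - c \<bullet> ten2 v w | c v w. True}"

definition rel3 :: "('k::field \<Rightarrow> 'u::ab_group_add \<Rightarrow> 'u) \<Rightarrow> ('k \<Rightarrow> 'v::ab_group_add \<Rightarrow> 'v)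
    \<Rightarrow> ('k \<Rightarrow> 'w::ab_group_add \<Rightarrow> 'w) \<Rightarrow> ('u \<times> 'v \<times> 'w \<Rightarrow>\<^sub>0 'k) set"
  where "rel3 sU sV sW =
      {ten3 (u + u') v w - ten3 u v w - ten3 u' v w | u u' v w. True}
    \<union> {ten3 u (v + v') w - ten3 u v w - ten3 u v' w | u v v' w. True}
    \<union> {ten3 u v (w + w') - ten3 u v w - ten3 u v w' | u v w w'. True}
    \<union> {ten3 (sU c u) v w - c \<bullet> ten3 u v w | c u v w. True}
    \<union> {ten3 u (sV c v) w - c \<bullet> ten3 u v w | c u v w. True}
    \<union> {ten3 u v (sW c w) - c \<bullet> ten3 u v w | c u v w. True}"

definition teq2 :: "('k::field \<Rightarrow> 'v::ab_group_add \<Rightarrow> 'v) \<Rightarrow> ('k \<Rightarrow> 'w::ab_group_add \<Rightarrow> 'w)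
    \<Rightarrow> ('v \<times> 'w \<Rightarrow>\<^sub>0 'k) \<Rightarrow> ('v \<times> 'w \<Rightarrow>\<^sub>0 'k) \<Rightarrow> bool"
  where "teq2 sV sW s t \<longleftrightarrow> s - t \<in> free.span (rel2 sV sW)"

definition teq3 :: "('k::field \<Rightarrow> 'u::ab_group_add \<Rightarrow> 'u) \<Rightarrow> ('k \<Rightarrow> 'v::ab_group_add \<Rightarrow> 'v)
    \<Rightarrow> ('k \<Rightarrow> 'w::ab_group_add \<Rightarrow> 'w)
    \<Rightarrow> ('u \<times> 'v \<times> 'w \<Rightarrow>\<^sub>0 'k) \<Rightarrow> ('u \<times> 'v \<times> 'w \<Rightarrow>\<^sub>0 'k) \<Rightarrow> bool"
  where "teq3 sU sV sW s t \<longleftrightarrow> s - t \<in> free.span (rel3 sU sV sW)"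

text \<open>
  Sweedler summation: for \<open>s = s\<^sup>1 \<otimes> s\<^sup>2\<close> (summation understood), \<open>sweedler s F\<close> is the sum
  \<open>F s\<^sup>1 s\<^sup>2\<close>, i.e. the linear extension of \<open>F\<close> evaluated at \<open>s\<close>.
\<close>

definition sweedler :: "('v \<times> 'w \<Rightarrow>\<^sub>0 'k::field) \<Rightarrow> ('v \<Rightarrow> 'w \<Rightarrow> ('z \<Rightarrow>\<^sub>0 'k)) \<Rightarrow> ('z \<Rightarrow>\<^sub>0 'k)"
  where "sweedler s F = (\<Sum>(v, w)\<in>Poly_Mapping.keys s. Poly_Mapping.lookup s (v, w) \<bullet> F v w)"

definition linear_to_tensor :: "('k::field \<Rightarrow> 'u::ab_group_add \<Rightarrow> 'u) \<Rightarrow>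
    ('k \<Rightarrow> 'v::ab_group_add \<Rightarrow> 'v) \<Rightarrow> ('k \<Rightarrow> 'w::ab_group_add \<Rightarrow> 'w) \<Rightarrow>
    ('u \<Rightarrow> ('v \<times> 'w \<Rightarrow>\<^sub>0 'k)) \<Rightarrow> bool"
  where "linear_to_tensor sU sV sW f \<longleftrightarrow>
    vector_space sU \<and> vector_space sV \<and> vector_space sW \<and>
    (\<forall>u u'. teq2 sV sW (f (u + u')) (f u + f u')) \<and>
    (\<forall>c u. teq2 sV sW (f (sU c u)) (c \<bullet> f u))"


section \<open>BiHom-associative algebras and their quasitriangular structures\<close>

locale bihom_assoc_algebra =
  fixes sA :: "'k::field \<Rightarrow> 'a::ab_group_add \<Rightarrow> 'a"
    and mult :: "'a \<Rightarrow> 'a \<Rightarrow> 'a"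
    and \<alpha> \<beta> :: "'a \<Rightarrow> 'a"
  assumes mult_linear_left: "\<And>b. Vector_Spaces.linear sA sA (\<lambda>a. mult a b)"
    and mult_linear_right: "\<And>a. Vector_Spaces.linear sA sA (mult a)"
    and \<alpha>_linear: "Vector_Spaces.linear sA sA \<alpha>"
    and \<beta>_linear: "Vector_Spaces.linear sA sA \<beta>"
    and \<alpha>_\<beta>: "\<alpha> \<circ> \<beta> = \<beta> \<circ> \<alpha>"
    and \<alpha>_mult: "\<And>a b. \<alpha> (mult a b) = mult (\<alpha> a) (\<alpha> b)"
    and \<beta>_mult: "\<And>a b. \<beta> (mult a b) = mult (\<beta> a) (\<beta> b)"
    and bihom_assoc: "\<And>a b c. mult (\<alpha> a) (mult b c) = mult (mult a b) (\<beta> c)"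

locale unitary_bihom_assoc_algebra = bihom_assoc_algebra sA mult \<alpha> \<beta>
  for sA :: "'k::field \<Rightarrow> 'a::ab_group_add \<Rightarrow> 'a"
    and mult :: "'a \<Rightarrow> 'a \<Rightarrow> 'a"
    and unit :: 'a
    and \<alpha> \<beta> :: "'a \<Rightarrow> 'a" +
  assumes \<alpha>_unit: "\<alpha> unit = unit"
    and \<beta>_unit: "\<beta> unit = unit"
    and mult_unit: "\<And>a. mult a unit = \<alpha> a"
    and unit_mult: "\<And>a. mult unit a = \<beta> a"

locale quasitriangular_infBH_bialgebra = unitary_bihom_assoc_algebra sA mult unit \<alpha> \<beta>
  for lam :: "'k::field"
    and sA :: "'k \<Rightarrow> 'a::ab_group_add \<Rightarrow> 'a"
    and mult :: "'a \<Rightarrow> 'a \<Rightarrow> 'a"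
    and unit :: 'a
    and \<alpha> \<beta> \<psi> \<omega> :: "'a \<Rightarrow> 'a"
    and r :: "'a \<times> 'a \<Rightarrow>\<^sub>0 'k" +
  assumes \<alpha>_bij: "bij \<alpha>"
    and \<beta>_bij: "bij \<beta>"
    and \<psi>_linear: "Vector_Spaces.linear sA sA \<psi>"
    and \<omega>_linear: "Vector_Spaces.linear sA sA \<omega>"
    and \<psi>_mult: "\<And>a b. \<psi> (mult a b) = mult (\<psi> a) (\<psi> b)"
    and \<omega>_mult: "\<And>a b. \<omega> (mult a b) = mult (\<omega> a) (\<omega> b)"
    and \<psi>_\<alpha>: "\<psi> \<circ> \<alpha> = \<alpha> \<circ> \<psi>"
    and \<psi>_\<beta>: "\<psi> \<circ> \<beta> = \<beta> \<circ> \<psi>"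
    and \<omega>_\<alpha>: "\<omega> \<circ> \<alpha> = \<alpha> \<circ> \<omega>"
    and \<omega>_\<beta>: "\<omega> \<circ> \<beta> = \<beta> \<circ> \<omega>"
    and \<psi>_unit: "\<psi> unit = unit"
    and \<omega>_unit: "\<omega> unit = unit"
    and r_invariant: "\<And>f. f \<in> {\<alpha>, \<beta>, \<psi>, \<omega>} \<Longrightarrow>
      teq2 sA sA (sweedler r (\<lambda>r1 r2. ten2 (f r1) (f r2))) r"
    and quasitriangular: "teq3 sA sA sA
      (sweedler r (\<lambda>r1 r2. sweedler r (\<lambda>r1' r2'.
          ten3 (mult (\<omega> r1) r1') (\<beta> r2') (\<alpha> (\<psi> r2))
        - ten3 (\<alpha> r1) (mult r2 r1') (\<beta> r2')
        + ten3 (\<beta> (\<omega> r1)) (\<alpha> r1') (mult r2' (\<psi> r2)))))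
      (lam \<bullet> sweedler r (\<lambda>r1 r2. ten3 (\<omega> r1) unit (\<psi> r2)))"

definition qt_comult :: "'k::field \<Rightarrow> ('a \<Rightarrow> 'a \<Rightarrow> 'a) \<Rightarrow> 'a \<Rightarrow>
    ('a \<Rightarrow> 'a) \<Rightarrow> ('a \<Rightarrow> 'a) \<Rightarrow> ('a \<Rightarrow> 'a) \<Rightarrow> ('a \<Rightarrow> 'a) \<Rightarrow>
    ('a \<times> 'a \<Rightarrow>\<^sub>0 'k) \<Rightarrow> 'a \<Rightarrow> ('a \<times> 'a \<Rightarrow>\<^sub>0 'k)"
  where "qt_comult lam mult unit \<alpha> \<beta> \<psi> \<omega> r a =
      sweedler r (\<lambda>r1 r2. ten2 (mult (\<omega> (inv \<alpha> a)) r1) (\<beta> r2))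
    - sweedler r (\<lambda>r1 r2. ten2 (\<alpha> r1) (mult r2 (\<psi> (inv \<beta> a))))
    - lam \<bullet> ten2 (\<omega> a) unit"


section \<open>Modules, comodules and Hopf modules\<close>

locale right_bihom_module = bihom_assoc_algebra sA mult \<alpha>A \<beta>A
  for sA :: "'k::field \<Rightarrow> 'a::ab_group_add \<Rightarrow> 'a"
    and mult :: "'a \<Rightarrow> 'a \<Rightarrow> 'a"
    and \<alpha>A \<beta>A :: "'a \<Rightarrow> 'a"
    and sM :: "'k \<Rightarrow> 'm::ab_group_add \<Rightarrow> 'm"
    and act :: "'m \<Rightarrow> 'a \<Rightarrow> 'm"
    and \<alpha>M \<beta>M :: "'m \<Rightarrow> 'm" +
  assumes act_linear_left: "\<And>a. Vector_Spaces.linear sM sM (\<lambda>m. act m a)"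
    and act_linear_right: "\<And>m. Vector_Spaces.linear sA sM (act m)"
    and \<alpha>M_linear: "Vector_Spaces.linear sM sM \<alpha>M"
    and \<beta>M_linear: "Vector_Spaces.linear sM sM \<beta>M"
    and \<alpha>M_\<beta>M: "\<alpha>M \<circ> \<beta>M = \<beta>M \<circ> \<alpha>M"
    and \<alpha>M_act: "\<And>m a. \<alpha>M (act m a) = act (\<alpha>M m) (\<alpha>A a)"
    and \<beta>M_act: "\<And>m a. \<beta>M (act m a) = act (\<beta>M m) (\<beta>A a)"
    and act_assoc: "\<And>m a a'. act (\<alpha>M m) (mult a a') = act (act m a) (\<beta>A a')"

locale right_bihom_comodule =
  fixes sA :: "'k::field \<Rightarrow> 'a::ab_group_add \<Rightarrow> 'a"
    and \<Delta> :: "'a \<Rightarrow> ('a \<times> 'a \<Rightarrow>\<^sub>0 'k)"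
    and \<psi>A \<omega>A :: "'a \<Rightarrow> 'a"
    and sM :: "'k \<Rightarrow> 'm::ab_group_add \<Rightarrow> 'm"
    and \<phi> :: "'m \<Rightarrow> ('m \<times> 'a \<Rightarrow>\<^sub>0 'k)"
    and \<psi>M \<omega>M :: "'m \<Rightarrow> 'm"
  assumes \<Delta>_linear: "linear_to_tensor sA sA sA \<Delta>"
    and \<psi>A_linear: "Vector_Spaces.linear sA sA \<psi>A"
    and \<omega>A_linear: "Vector_Spaces.linear sA sA \<omega>A"
    and \<phi>_linear: "linear_to_tensor sM sM sA \<phi>"
    and \<psi>M_linear: "Vector_Spaces.linear sM sM \<psi>M"
    and \<omega>M_linear: "Vector_Spaces.linear sM sM \<omega>M"
    and \<psi>M_\<omega>M: "\<psi>M \<circ> \<omega>M = \<omega>M \<circ> \<psi>M"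
    and \<psi>_colinear: "\<And>m. teq2 sM sA
      (sweedler (\<phi> m) (\<lambda>m0 m1. ten2 (\<psi>M m0) (\<psi>A m1))) (\<phi> (\<psi>M m))"
    and \<omega>_colinear: "\<And>m. teq2 sM sA
      (sweedler (\<phi> m) (\<lambda>m0 m1. ten2 (\<omega>M m0) (\<omega>A m1))) (\<phi> (\<omega>M m))"
    and coassoc: "\<And>m. teq3 sM sA sA
      (sweedler (\<phi> m) (\<lambda>m0 m1. sweedler (\<Delta> m1) (\<lambda>a1 a2. ten3 (\<omega>M m0) a1 a2)))
      (sweedler (\<phi> m) (\<lambda>m0 m1. sweedler (\<phi> m0) (\<lambda>n0 n1. ten3 n0 n1 (\<psi>A m1))))"

locale right_infBH_Hopf_module =
    right_bihom_module sA mult \<alpha>A \<beta>A sM act \<alpha>M \<beta>M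
  + right_bihom_comodule sA \<Delta> \<psi>A \<omega>A sM \<phi> \<psi>M \<omega>M
  for lam :: "'k::field"
    and sA :: "'k \<Rightarrow> 'a::ab_group_add \<Rightarrow> 'a"
    and mult :: "'a \<Rightarrow> 'a \<Rightarrow> 'a"
    and \<Delta> :: "'a \<Rightarrow> ('a \<times> 'a \<Rightarrow>\<^sub>0 'k)"
    and \<alpha>A \<beta>A \<psi>A \<omega>A :: "'a \<Rightarrow> 'a"
    and sM :: "'k \<Rightarrow> 'm::ab_group_add \<Rightarrow> 'm"
    and act :: "'m \<Rightarrow> 'a \<Rightarrow> 'm"
    and \<phi> :: "'m \<Rightarrow> ('m \<times> 'a \<Rightarrow>\<^sub>0 'k)"
    and \<alpha>M \<beta>M \<psi>M \<omega>M :: "'m \<Rightarrow> 'm" +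
  assumes maps_commute: "\<And>f g. f \<in> {\<alpha>M, \<beta>M, \<psi>M, \<omega>M} \<Longrightarrow> g \<in> {\<alpha>M, \<beta>M, \<psi>M, \<omega>M} \<Longrightarrow>
      f \<circ> g = g \<circ> f"
    and Hopf_compatible: "\<And>m a. teq2 sM sA (\<phi> (act m a))
      (sweedler (\<Delta> a) (\<lambda>a1 a2. ten2 (act (\<omega>M m) a1) (\<beta>A a2))
     + sweedler (\<phi> m) (\<lambda>m0 m1. ten2 (\<alpha>M m0) (mult m1 (\<psi>A a)))
     + lam \<bullet> ten2 (\<alpha>M (\<omega>M m)) (\<beta>A (\<psi>A a)))"

end

theory Submission
  imports Defs
begin

text \<open>
  Over a field, two tensors are equal iff every multilinear form takes the same value on them, so
  each Hopf module axiom becomes an equation between scalars. Compatibility and colinearity then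
  only use invariance of \<open>r\<close>. In coassociativity the terms involving \<open>\<Delta>\<^sub>r(1) = -\<lambda> 1 \<otimes> 1\<close> cancel,
  and the rest is the quasitriangularity equation acting on \<open>M\<close> through its first leg.
\<close>

section \<open>Detecting tensors by multilinear forms\<close>

text \<open>The linear extension of \<open>f\<close> from basis elements to the free vector space.
  By \<open>linear_eq_free_eval\<close>, every linear functional there arises this way.\<close>

definition free_eval :: "('x \<Rightarrow>\<^sub>0 'k::field) \<Rightarrow> ('x \<Rightarrow> 'k) \<Rightarrow> 'k"
  where "free_eval s f = (\<Sum>x\<in>Poly_Mapping.keys s. Poly_Mapping.lookup s x * f x)"

lemma free_eval_superset:
  assumes "finite X" "Poly_Mapping.keys s \<subseteq> X"
  shows "free_eval s f = (\<Sum>x\<in>X. Poly_Mapping.lookup s x * f x)"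
  unfolding free_eval_def
  by (rule sum.mono_neutral_left) (use assms in \<open>auto simp: in_keys_iff\<close>)

lemma free_eval_add: "free_eval (s + t) f = free_eval s f + free_eval t f"
proof -
  let ?X = "Poly_Mapping.keys s \<union> Poly_Mapping.keys t"
  have "Poly_Mapping.keys (s + t) \<subseteq> ?X"
    by (rule Poly_Mapping.keys_add)
  then show ?thesis
    by (simp add: free_eval_superset[of ?X] Poly_Mapping.lookup_add algebra_simps sum.distrib)
qed

lemma free_eval_fscale: "free_eval (c \<bullet> s) f = c * free_eval s f"
proof -
  have "Poly_Mapping.keys (c \<bullet> s) \<subseteq> Poly_Mapping.keys s"
    by (auto simp: in_keys_iff)
  then show ?thesis
    by (simp add: free_eval_superset[of "Poly_Mapping.keys s"] sum_distrib_left mult.assoc)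
qed

lemma free_eval_0 [simp]: "free_eval 0 f = 0"
  by (simp add: free_eval_def)

lemma free_eval_diff: "free_eval (s - t) f = free_eval s f - free_eval t f"
  using free_eval_add[of "s - t" t f] by simp

lemma free_eval_single [simp]: "free_eval (Poly_Mapping.single x 1) f = f x"
  by (simp add: free_eval_def)

lemma free_eval_sum: "free_eval (sum g X) f = (\<Sum>x\<in>X. free_eval (g x) f)"
  by (induction X rule: infinite_finite_induct) (simp_all add: free_eval_add)

lemma free_eval_sweedler:
  "free_eval (sweedler s F) f = free_eval s (\<lambda>(v, w). free_eval (F v w) f)"
  by (simp add: sweedler_def free_eval_sum free_eval_fscale case_prod_beta free_eval_def[of s])

lemma linear_eq_free_eval:
  assumes "Vector_Spaces.linear fscale (*) g"
  shows "g s = free_eval s (\<lambda>x. g (Poly_Mapping.single x 1))"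
proof -
  interpret g: Vector_Spaces.linear fscale "(*)" g by fact
  have "s = (\<Sum>x\<in>Poly_Mapping.keys s. Poly_Mapping.lookup s x \<bullet> Poly_Mapping.single x 1)"
    by (rule poly_mapping_eqI)
      (auto simp: lookup_sum lookup_single when_def in_keys_iff if_distrib cong: if_cong)
  then have "g s = g (\<Sum>x\<in>Poly_Mapping.keys s. Poly_Mapping.lookup s x \<bullet> Poly_Mapping.single x 1)"
    by simp
  then show ?thesis
    by (simp add: g.sum g.scale free_eval_def)
qed

text \<open>Over a field, linear functionals separate a subspace from any vector outside it. This is
  what reduces congruence modulo relators to scalar equations.\<close>

lemma mem_span_iff_free_eval:
  "s \<in> free.span R \<longleftrightarrow>
    (\<forall>f. (\<forall>x\<in>R. free_eval x f = 0) \<longrightarrow> free_eval s f = 0)" (is "_ \<longleftrightarrow> ?R")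
proof
  assume s: "s \<in> free.span R"
  show ?R
  proof (intro allI impI)
    fix f assume "\<forall>x\<in>R. free_eval x f = (0 :: 'b)"
    with s show "free_eval s f = 0"
      by (induction rule: free.span_induct_alt) (auto simp: free_eval_add free_eval_fscale)
  qed
next
  assume R: ?R
  show "s \<in> free.span R"
  proof (rule ccontr)
    assume s: "s \<notin> free.span R"
    interpret K: vector_space "(*) :: 'b \<Rightarrow> 'b \<Rightarrow> 'b"
      by unfold_locales (simp_all add: algebra_simps)
    interpret vp: vector_space_pair "fscale :: 'b \<Rightarrow> ('a \<Rightarrow>\<^sub>0 'b) \<Rightarrow> _" "(*) :: 'b \<Rightarrow> 'b \<Rightarrow> 'b" ..
    \<comment> \<open>If \<open>s\<close> lies outside the span, adjoining it to a basis of the span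
      keeps independence. The functional that is 1 at \<open>s\<close> and 0 on \<open>B\<close>
      therefore exists, vanishes on \<open>R\<close>, and contradicts the assumption.\<close>
    obtain B where B: "B \<subseteq> R" "free.independent B" "free.span R = free.span B"
      using free.maximal_independent_subset[of R] free.span_mono free.span_span
      by (metis (no_types, lifting) subset_antisym)
    have "free.independent (insert s B)"
      using s B by (simp add: free.independent_insert)
    then obtain g where g: "Vector_Spaces.linear fscale (*) g"
      "\<And>x. x \<in> insert s B \<Longrightarrow> g x = (if x = s then 1 else 0)"
      using vp.linear_independent_extend[of "insert s B" "\<lambda>x. if x = s then 1 else 0"] by blast
    interpret g: Vector_Spaces.linear fscale "(*)" g by fact
    have "g x = 0" if "x \<in> B" for x
      using g(2)[of x] that s B by (auto simp: free.span_base)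
    then have "g x = 0" if "x \<in> free.span B" for x
      using that by (rule g.eq_0_on_span)
    then have "\<forall>x\<in>R. free_eval x (\<lambda>x. g (Poly_Mapping.single x 1)) = 0"
      using B(3) free.span_base by (metis linear_eq_free_eval[OF g(1)])
    with R have "g s = 0"
      by (metis linear_eq_free_eval[OF g(1)])
    with g(2)[of s] show False by simp
  qed
qed

section \<open>Multilinear forms and equality of tensors\<close>

definition eval2 :: "('v \<times> 'w \<Rightarrow>\<^sub>0 'k::field) \<Rightarrow> ('v \<Rightarrow> 'w \<Rightarrow> 'k) \<Rightarrow> 'k"
  where "eval2 s f = free_eval s (\<lambda>(v, w). f v w)"

definition eval3 :: "('u \<times> 'v \<times> 'w \<Rightarrow>\<^sub>0 'k::field) \<Rightarrow> ('u \<Rightarrow> 'v \<Rightarrow> 'w \<Rightarrow> 'k) \<Rightarrow> 'k"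
  where "eval3 s f = free_eval s (\<lambda>(u, v, w). f u v w)"

lemma eval2_simps [simp]:
  "eval2 (s + t) f = eval2 s f + eval2 t f"
  "eval2 (s - t) f = eval2 s f - eval2 t f"
  "eval2 (c \<bullet> s) f = c * eval2 s f"
  "eval2 (ten2 v w) f = f v w"
  "eval2 (sweedler p F) f = eval2 p (\<lambda>x y. eval2 (F x y) f)"
  by (simp_all add: eval2_def free_eval_add free_eval_diff free_eval_fscale free_eval_sweedler)

lemma eval3_simps [simp]:
  "eval3 (s + t) f = eval3 s f + eval3 t f"
  "eval3 (s - t) f = eval3 s f - eval3 t f"
  "eval3 (c \<bullet> s) f = c * eval3 s f"
  "eval3 (ten3 u v w) f = f u v w"
  "eval3 (sweedler p F) f = eval2 p (\<lambda>x y. eval3 (F x y) f)"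
  by (simp_all add: eval2_def eval3_def free_eval_add free_eval_diff free_eval_fscale
      free_eval_sweedler)

text \<open>Needed for iterated sums over \<open>r\<close>: an inner evaluation is itself a form in
  the outer variables, and these rules expand it and prove it bilinear.\<close>

lemma eval2_form:
  "eval2 s (\<lambda>x y. f x y + g x y) = eval2 s f + eval2 s g"
  "eval2 s (\<lambda>x y. f x y - g x y) = eval2 s f - eval2 s g"
  "eval2 s (\<lambda>x y. c * f x y) = c * eval2 s f"
  by (simp_all add: eval2_def free_eval_def case_prod_beta algebra_simps sum.distrib
      sum_subtractf sum_distrib_left)

definition bilinear_form :: "('k::field \<Rightarrow> 'v::ab_group_add \<Rightarrow> 'v) \<Rightarrow>
    ('k \<Rightarrow> 'w::ab_group_add \<Rightarrow> 'w) \<Rightarrow> ('v \<Rightarrow> 'w \<Rightarrow> 'k) \<Rightarrow> bool"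
  where "bilinear_form sV sW f \<longleftrightarrow>
    (\<forall>v v' w. f (v + v') w = f v w + f v' w) \<and> (\<forall>v w w'. f v (w + w') = f v w + f v w') \<and>
    (\<forall>c v w. f (sV c v) w = c * f v w) \<and> (\<forall>c v w. f v (sW c w) = c * f v w)"

definition trilinear_form :: "('k::field \<Rightarrow> 'u::ab_group_add \<Rightarrow> 'u) \<Rightarrow>
    ('k \<Rightarrow> 'v::ab_group_add \<Rightarrow> 'v) \<Rightarrow> ('k \<Rightarrow> 'w::ab_group_add \<Rightarrow> 'w) \<Rightarrow>
    ('u \<Rightarrow> 'v \<Rightarrow> 'w \<Rightarrow> 'k) \<Rightarrow> bool"
  where "trilinear_form sU sV sW f \<longleftrightarrow>
    (\<forall>u u' v w. f (u + u') v w = f u v w + f u' v w) \<and>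
    (\<forall>u v v' w. f u (v + v') w = f u v w + f u v' w) \<and>
    (\<forall>u v w w'. f u v (w + w') = f u v w + f u v w') \<and>
    (\<forall>c u v w. f (sU c u) v w = c * f u v w) \<and>
    (\<forall>c u v w. f u (sV c v) w = c * f u v w) \<and>
    (\<forall>c u v w. f u v (sW c w) = c * f u v w)"

lemma ball_range3: "(\<forall>x\<in>{g a b c | a b c. True}. P x) \<longleftrightarrow> (\<forall>a b c. P (g a b c))"
  by blast

lemma ball_range4: "(\<forall>x\<in>{g a b c d | a b c d. True}. P x) \<longleftrightarrow> (\<forall>a b c d. P (g a b c d))"
  by blast

text \<open>Each family of relators encodes one law of bilinearity, so this is the universal
  property of the tensor product at the level of scalar-valued maps.\<close>

lemma free_eval_rel2:
  "(\<forall>x\<in>rel2 sV sW. free_eval x f = 0) \<longleftrightarrow> bilinear_form sV sW (\<lambda>v w. f (v, w))"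
  unfolding rel2_def bilinear_form_def ball_Un ball_range3
  by (simp add: free_eval_diff free_eval_fscale diff_eq_eq add.commute)

lemma free_eval_rel3:
  "(\<forall>x\<in>rel3 sU sV sW. free_eval x f = 0) \<longleftrightarrow> trilinear_form sU sV sW (\<lambda>u v w. f (u, v, w))"
  unfolding rel3_def trilinear_form_def ball_Un ball_range4
  by (simp add: free_eval_diff free_eval_fscale diff_eq_eq add.commute)

lemma teq2_iff_eval2:
  "teq2 sV sW s t \<longleftrightarrow> (\<forall>f. bilinear_form sV sW f \<longrightarrow> eval2 s f = eval2 t f)"
proof -
  have "teq2 sV sW s t \<longleftrightarrow> (\<forall>f. bilinear_form sV sW (\<lambda>v w. f (v, w)) \<longrightarrow>
      free_eval s f = free_eval t f)"
    by (simp add: teq2_def mem_span_iff_free_eval free_eval_rel2 free_eval_diff)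
  also have "\<dots> \<longleftrightarrow> (\<forall>f. bilinear_form sV sW f \<longrightarrow> eval2 s f = eval2 t f)"
    \<comment> \<open>The two formulations differ only by currying; each direction instantiates the
      quantified form with its curried or uncurried counterpart.\<close>
    unfolding eval2_def by (rule iffI; rule allI)
      (drule_tac x = "\<lambda>(v, w). f v w" in spec, simp, drule_tac x = "\<lambda>v w. f (v, w)" in spec, simp)
  finally show ?thesis .
qed

lemma teq3_iff_eval3:
  "teq3 sU sV sW s t \<longleftrightarrow> (\<forall>f. trilinear_form sU sV sW f \<longrightarrow> eval3 s f = eval3 t f)"
proof -
  have "teq3 sU sV sW s t \<longleftrightarrow> (\<forall>f. trilinear_form sU sV sW (\<lambda>u v w. f (u, v, w)) \<longrightarrow>
      free_eval s f = free_eval t f)"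
    by (simp add: teq3_def mem_span_iff_free_eval free_eval_rel3 free_eval_diff)
  also have "\<dots> \<longleftrightarrow> (\<forall>f. trilinear_form sU sV sW f \<longrightarrow> eval3 s f = eval3 t f)"
    unfolding eval3_def by (rule iffI; rule allI)
      (drule_tac x = "\<lambda>(u, v, w). f u v w" in spec, simp,
       drule_tac x = "\<lambda>u v w. f (u, v, w)" in spec, simp)
  finally show ?thesis .
qed

lemma linear_simps:
  assumes "Vector_Spaces.linear s1 s2 f"
  shows "f (x + y) = f x + f y" "f (s1 c x) = s2 c (f x)"
  using assms[THEN Vector_Spaces.linear.axioms(3)] by (simp_all add: module_hom.add module_hom.scale)


section \<open>The coaction induced by a quasitriangular structure\<close>

locale quasitriangular_module =
    quasitriangular_infBH_bialgebra lam sA mult unit \<alpha>A \<beta>A \<psi>A \<omega>A r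
  + right_bihom_module sA mult \<alpha>A \<beta>A sM act \<alpha>M \<beta>M
  for lam :: "'k::field"
    and sA :: "'k \<Rightarrow> 'a::ab_group_add \<Rightarrow> 'a"
    and mult :: "'a \<Rightarrow> 'a \<Rightarrow> 'a"
    and unit :: 'a
    and \<alpha>A \<beta>A \<psi>A \<omega>A :: "'a \<Rightarrow> 'a"
    and r :: "'a \<times> 'a \<Rightarrow>\<^sub>0 'k"
    and sM :: "'k \<Rightarrow> 'm::ab_group_add \<Rightarrow> 'm"
    and act :: "'m \<Rightarrow> 'a \<Rightarrow> 'm"
    and \<alpha>M \<beta>M :: "'m \<Rightarrow> 'm" +
  fixes \<psi>M \<omega>M :: "'m \<Rightarrow> 'm"
  assumes \<alpha>M_bij: "bij \<alpha>M"
    and \<psi>M_linear: "Vector_Spaces.linear sM sM \<psi>M"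
    and \<omega>M_linear: "Vector_Spaces.linear sM sM \<omega>M"
    and \<alpha>M_\<omega>M: "\<alpha>M \<circ> \<omega>M = \<omega>M \<circ> \<alpha>M"
    and \<omega>M_act: "\<omega>M (act m a) = act (\<omega>M m) (\<omega>A a)"
    and \<beta>M_\<omega>M: "\<beta>M \<circ> \<omega>M = \<omega>M \<circ> \<beta>M"
    and \<alpha>M_\<psi>M: "\<alpha>M \<circ> \<psi>M = \<psi>M \<circ> \<alpha>M"
    and \<beta>M_\<psi>M: "\<beta>M \<circ> \<psi>M = \<psi>M \<circ> \<beta>M"
    and \<omega>M_\<psi>M: "\<omega>M \<circ> \<psi>M = \<psi>M \<circ> \<omega>M"
    and \<psi>M_act: "\<psi>M (act m a) = act (\<psi>M m) (\<psi>A a)"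
begin

definition coact :: "'m \<Rightarrow> ('m \<times> 'a \<Rightarrow>\<^sub>0 'k)"
  where "coact m = sweedler r (\<lambda>r1 r2. ten2 (act (\<omega>M (inv \<alpha>M m)) r1) (\<beta>A r2))
    - lam \<bullet> ten2 (\<omega>M m) unit"

abbreviation \<Delta>\<^sub>r :: "'a \<Rightarrow> ('a \<times> 'a \<Rightarrow>\<^sub>0 'k)"
  where "\<Delta>\<^sub>r \<equiv> qt_comult lam mult unit \<alpha>A \<beta>A \<psi>A \<omega>A r"

section \<open>Inverses and commutation of the structure maps\<close>

lemma inv_simps [simp]:
  "\<alpha>A (inv \<alpha>A a) = a" "inv \<alpha>A (\<alpha>A a) = a"
  "\<beta>A (inv \<beta>A a) = a" "inv \<beta>A (\<beta>A a) = a"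
  "\<alpha>M (inv \<alpha>M m) = m" "inv \<alpha>M (\<alpha>M m) = m"
  using \<alpha>_bij \<beta>_bij \<alpha>M_bij
  by (simp_all add: bij_is_inj bij_is_surj surj_f_inv_f)

text \<open>Clearing the inverse from an equation lets linearity and commutation of the inverses be
  inherited from the maps themselves.\<close>

lemma inv_eqs:
  "inv \<alpha>A a = b \<longleftrightarrow> a = \<alpha>A b" "inv \<beta>A a = b \<longleftrightarrow> a = \<beta>A b" "inv \<alpha>M m = n \<longleftrightarrow> m = \<alpha>M n"
  by (metis inv_simps)+

lemmas hom_linear = linear_simps[OF mult_linear_left] linear_simps[OF mult_linear_right]
  linear_simps[OF \<alpha>_linear] linear_simps[OF \<beta>_linear] linear_simps[OF \<psi>_linear]
  linear_simps[OF \<omega>_linear] linear_simps[OF act_linear_left] linear_simps[OF act_linear_right]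
  linear_simps[OF \<alpha>M_linear] linear_simps[OF \<omega>M_linear] linear_simps[OF \<psi>M_linear]

lemma inv_linear:
  "inv \<alpha>A (a + b) = inv \<alpha>A a + inv \<alpha>A b" "inv \<alpha>A (sA c a) = sA c (inv \<alpha>A a)"
  "inv \<beta>A (a + b) = inv \<beta>A a + inv \<beta>A b" "inv \<beta>A (sA c a) = sA c (inv \<beta>A a)"
  "inv \<alpha>M (m + n) = inv \<alpha>M m + inv \<alpha>M n" "inv \<alpha>M (sM c m) = sM c (inv \<alpha>M m)"
  by (simp_all add: inv_eqs hom_linear)

lemmas maps_comm = \<alpha>_\<beta>[THEN fun_cong, simplified] \<psi>_\<alpha>[THEN fun_cong, simplified]
  \<psi>_\<beta>[THEN fun_cong, simplified] \<omega>_\<alpha>[THEN fun_cong, simplified]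
  \<omega>_\<beta>[THEN fun_cong, simplified]
  \<alpha>M_\<omega>M[THEN fun_cong, simplified] \<alpha>M_\<psi>M[THEN fun_cong, simplified]
  \<omega>M_\<psi>M[THEN fun_cong, simplified]

lemma inv_hom:
  "inv \<alpha>M (\<omega>M m) = \<omega>M (inv \<alpha>M m)"
  "inv \<alpha>M (\<psi>M m) = \<psi>M (inv \<alpha>M m)"
  "inv \<alpha>M (act m a) = act (inv \<alpha>M m) (inv \<alpha>A a)"
  "inv \<beta>A (mult a b) = mult (inv \<beta>A a) (inv \<beta>A b)"
  "inv \<beta>A (\<alpha>A a) = \<alpha>A (inv \<beta>A a)"
  "inv \<alpha>A (\<beta>A a) = \<beta>A (inv \<alpha>A a)"
  "\<omega>A (inv \<alpha>A a) = inv \<alpha>A (\<omega>A a)"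
  "\<omega>A (inv \<beta>A a) = inv \<beta>A (\<omega>A a)"
  "inv \<alpha>A unit = unit" "inv \<beta>A unit = unit"
proof -
  \<comment> \<open>Here the inverse does not head the left-hand side, so \<open>inv_eqs\<close>
    does not apply; the claim follows from commutation at \<open>inv \<alpha>A a\<close>.\<close>
  show "\<omega>A (inv \<alpha>A a) = inv \<alpha>A (\<omega>A a)"
    by (metis inv_simps(1,2) maps_comm(4))
  show "\<omega>A (inv \<beta>A a) = inv \<beta>A (\<omega>A a)"
    by (metis inv_simps(3,4) maps_comm(5))
qed (simp_all add: inv_eqs \<alpha>M_act \<beta>_mult \<alpha>_unit \<beta>_unit flip: maps_comm,
     simp_all add: maps_comm)

section \<open>Evaluation of the coaction and invariance of \<open>r\<close>\<close>

lemma eval2_coact [simp]: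
  "eval2 (coact m) f =
    eval2 r (\<lambda>x y. f (act (\<omega>M (inv \<alpha>M m)) x) (\<beta>A y)) - lam * f (\<omega>M m) unit"
  by (simp add: coact_def)

lemma eval2_comult [simp]:
  "eval2 (\<Delta>\<^sub>r a) f = eval2 r (\<lambda>x y. f (mult (\<omega>A (inv \<alpha>A a)) x) (\<beta>A y))
    - eval2 r (\<lambda>x y. f (\<alpha>A x) (mult y (\<psi>A (inv \<beta>A a)))) - lam * f (\<omega>A a) unit"
  by (simp add: qt_comult_def)

lemma eval_r_invariant:
  assumes "bilinear_form sA sA f" "g \<in> {\<alpha>A, \<beta>A, \<psi>A, \<omega>A}"
  shows "eval2 r (\<lambda>x y. f (g x) (g y)) = eval2 r f"
  using r_invariant[OF assms(2)] assms(1) by (simp add: teq2_iff_eval2)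

text \<open>Invariance applied to a form with an inverse in one slot: the inverse cancels in that
  leg and the map survives in the other. Twists can thus be moved between the two legs of
  \<open>r\<close>.\<close>

lemma eval_r_shift:
  assumes "bilinear_form sA sA f"
  shows "eval2 r (\<lambda>x y. f (inv \<alpha>A x) y) = eval2 r (\<lambda>x y. f x (\<alpha>A y))"
    and "eval2 r (\<lambda>x y. f (inv \<beta>A x) y) = eval2 r (\<lambda>x y. f x (\<beta>A y))"
    and "eval2 r (\<lambda>x y. f x (inv \<alpha>A y)) = eval2 r (\<lambda>x y. f (\<alpha>A x) y)"
  using eval_r_invariant[of "\<lambda>x y. f (inv \<alpha>A x) y" \<alpha>A]
    eval_r_invariant[of "\<lambda>x y. f (inv \<beta>A x) y" \<beta>A]
    eval_r_invariant[of "\<lambda>x y. f x (inv \<alpha>A y)" \<alpha>A] assms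
  by (simp_all add: bilinear_form_def inv_linear)

lemma linear_to_tensor_coact: "linear_to_tensor sM sM sA coact"
  unfolding linear_to_tensor_def teq2_iff_eval2
  \<comment> \<open>\<open>linear_to_tensor\<close> also asks for the vector space structures on M
    and A, which are part of these two linearity facts.\<close>
  using \<alpha>M_linear \<alpha>_linear
  by (auto simp: Vector_Spaces.linear_def bilinear_form_def hom_linear inv_linear eval2_form
      algebra_simps)

lemma linear_to_tensor_comult: "linear_to_tensor sA sA sA \<Delta>\<^sub>r"
  unfolding linear_to_tensor_def teq2_iff_eval2
  using \<alpha>_linear
  by (auto simp: Vector_Spaces.linear_def bilinear_form_def hom_linear inv_linear eval2_form
      algebra_simps)

section \<open>Colinearity and Hopf compatibility\<close>

text \<open>Since \<open>\<psi>M\<close> is compatible with the action and commutes with the other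
  twists, applying it to the coaction only applies \<open>\<psi>A\<close> to both legs of
  \<open>r\<close>, which invariance removes; the unit term is fixed by
  \<open>\<psi>A\<close>.\<close>

lemma psi_colinear:
  "teq2 sM sA (sweedler (coact m) (\<lambda>m0 m1. ten2 (\<psi>M m0) (\<psi>A m1))) (coact (\<psi>M m))"
  unfolding teq2_iff_eval2
proof (intro allI impI)
  fix f assume f: "bilinear_form sM sA f"
  have "eval2 r (\<lambda>x y. f (act n (\<psi>A x)) (\<beta>A (\<psi>A y))) = eval2 r (\<lambda>x y. f (act n x) (\<beta>A y))" for n
    by (rule eval_r_invariant[of "\<lambda>x y. f (act n x) (\<beta>A y)"])
      (use f in \<open>simp_all add: bilinear_form_def hom_linear\<close>)
  then show "eval2 (sweedler (coact m) (\<lambda>m0 m1. ten2 (\<psi>M m0) (\<psi>A m1))) f = eval2 (coact (\<psi>M m)) f"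
    by (simp add: \<psi>M_act inv_hom maps_comm \<psi>_unit)
qed

lemma omega_colinear:
  "teq2 sM sA (sweedler (coact m) (\<lambda>m0 m1. ten2 (\<omega>M m0) (\<omega>A m1))) (coact (\<omega>M m))"
  unfolding teq2_iff_eval2
proof (intro allI impI)
  fix f assume f: "bilinear_form sM sA f"
  have "eval2 r (\<lambda>x y. f (act n (\<omega>A x)) (\<beta>A (\<omega>A y))) = eval2 r (\<lambda>x y. f (act n x) (\<beta>A y))" for n
    by (rule eval_r_invariant[of "\<lambda>x y. f (act n x) (\<beta>A y)"])
      (use f in \<open>simp_all add: bilinear_form_def hom_linear\<close>)
  then show "eval2 (sweedler (coact m) (\<lambda>m0 m1. ten2 (\<omega>M m0) (\<omega>A m1))) f = eval2 (coact (\<omega>M m)) f"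
    by (simp add: \<omega>M_act inv_hom maps_comm \<omega>_unit)
qed

text \<open>The first term of \<open>\<Delta>\<^sub>r\<close> gives the first term of the coaction
  by module associativity and \<beta>-invariance of \<open>r\<close>. Its second term cancels
  against the \<open>r\<close>-part of \<open>coact m\<close>, its third is the unit term of
  \<open>coact (act m a)\<close>, and the last summand cancels the unit part of
  \<open>coact m\<close>.\<close>

lemma Hopf_compatible_coact:
  "teq2 sM sA (coact (act m a))
    (sweedler (\<Delta>\<^sub>r a) (\<lambda>a1 a2. ten2 (act (\<omega>M m) a1) (\<beta>A a2))
   + sweedler (coact m) (\<lambda>m0 m1. ten2 (\<alpha>M m0) (mult m1 (\<psi>A a)))
   + lam \<bullet> ten2 (\<alpha>M (\<omega>M m)) (\<beta>A (\<psi>A a)))"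
  unfolding teq2_iff_eval2
proof (intro allI impI)
  fix f assume f: "bilinear_form sM sA f"
  let ?n = "\<omega>M (inv \<alpha>M m)" and ?b = "\<omega>A (inv \<alpha>A a)"
  \<comment> \<open>Module associativity applies because \<open>\<omega>M m\<close> is the image of
    \<open>?n\<close> under \<open>\<alpha>M\<close>.\<close>
  have assoc: "act (\<omega>M m) (mult b x) = act (act ?n b) (\<beta>A x)" for b x
    by (simp add: maps_comm flip: act_assoc)
  have "eval2 r (\<lambda>x y. f (act (act ?n ?b) (\<beta>A x)) (\<beta>A (\<beta>A y)))
      = eval2 r (\<lambda>x y. f (act (act ?n ?b) x) (\<beta>A y))"
    by (rule eval_r_invariant[of "\<lambda>x y. f (act (act ?n ?b) x) (\<beta>A y)"])
      (use f in \<open>simp_all add: bilinear_form_def hom_linear\<close>)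
  then show "eval2 (coact (act m a)) f = eval2
    (sweedler (\<Delta>\<^sub>r a) (\<lambda>a1 a2. ten2 (act (\<omega>M m) a1) (\<beta>A a2))
   + sweedler (coact m) (\<lambda>m0 m1. ten2 (\<alpha>M m0) (mult m1 (\<psi>A a)))
   + lam \<bullet> ten2 (\<alpha>M (\<omega>M m)) (\<beta>A (\<psi>A a))) f"
    by (simp add: \<omega>M_act inv_hom(1-3) assoc \<alpha>M_act \<beta>_mult \<beta>_unit unit_mult maps_comm
        flip: maps_comm(3))
qed

section \<open>Quasitriangularity on the module and coassociativity\<close>

text \<open>The quasitriangularity equation transported along \<open>x \<otimes> y \<otimes> z \<mapsto> \<alpha>(p) \<triangleleft> \<beta>\<^sup>-\<^sup>1(x) \<otimes> y \<otimes> z\<close>;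
  invariance of \<open>r\<close> moves the remaining twists to where coassociativity needs them.\<close>

lemma act_quasitriangular:
  assumes f: "trilinear_form sM sA sA f"
  shows "eval2 r (\<lambda>x y. eval2 r (\<lambda>x' y'.
        f (act (\<alpha>M p) (\<omega>A x)) (mult (\<omega>A (inv \<alpha>A (\<beta>A y))) x') (\<beta>A y')))
    - eval2 r (\<lambda>x y. eval2 r (\<lambda>x' y'. f (act (\<alpha>M p) (\<omega>A x)) (\<alpha>A x') (mult y' (\<psi>A y))))
    = eval2 r (\<lambda>x y. eval2 r (\<lambda>x' y'.
        f (act (act p (\<omega>A (inv \<alpha>A x))) x') (\<beta>A y') (\<psi>A (\<beta>A y))))
    - lam * eval2 r (\<lambda>x y. f (act (\<alpha>M p) (\<omega>A x)) unit (\<psi>A (\<beta>A y)))"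
    (is "?L1 - ?L2 = ?R1 - lam * ?R2")
proof -
  note lin = trilinear_form_def bilinear_form_def hom_linear inv_linear eval2_form
  \<comment> \<open>Evaluating the inner copy of \<open>r\<close> first leaves bilinear forms in the
    outer copy, to which the invariance lemmas apply.\<close>
  define h1 where "h1 x y = eval2 r (\<lambda>x' y'. f (act (\<alpha>M p) x) (mult y x') (\<beta>A y'))" for x y
  define h2 where
    "h2 x y = eval2 r (\<lambda>x' y'. f (act (act p (\<omega>A x)) x') (\<beta>A y') (\<psi>A y))" for x y
  define h3 where "h3 x y = f (act (\<alpha>M p) (\<omega>A x)) unit (\<psi>A y)" for x y
  have h: "bilinear_form sA sA h1" "bilinear_form sA sA h2" "bilinear_form sA sA h3"
    using f by (simp_all add: h1_def h2_def h3_def lin)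
  \<comment> \<open>The factor \<open>inv \<beta>A\<close> cancels the \<beta> that module
    associativity puts on the second factor, and \<open>\<alpha>M p\<close> supplies the twist
    associativity requires. The product in the first leg thus becomes two successive actions on
    \<open>p\<close>.\<close>
  have "trilinear_form sA sA sA (\<lambda>x y z. f (act (\<alpha>M p) (inv \<beta>A x)) y z)"
    using f by (simp add: lin)
  with quasitriangular have
    "eval2 r (\<lambda>x y. h2 (inv \<beta>A x) (\<alpha>A y)) - eval2 r (\<lambda>x y. h1 (inv \<beta>A (\<alpha>A x)) y) + ?L2
     = lam * eval2 r (\<lambda>x y. h3 (inv \<beta>A x) y)"
    unfolding teq3_iff_eval3
    by (force simp: h1_def h2_def h3_def eval2_form inv_hom(4,8) act_assoc maps_comm(2))
  \<comment> \<open>First \<omega>-invariance strips \<omega> from both legs; then the \<alpha> and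
    \<beta> twists are shifted from the second leg to the first.\<close>
  moreover have "?L1 = eval2 r (\<lambda>x y. h1 (inv \<beta>A (\<alpha>A x)) y)"
  proof -
    have "?L1 = eval2 r (\<lambda>x y. h1 (\<omega>A x) (inv \<alpha>A (\<beta>A (\<omega>A y))))"
      by (simp add: h1_def inv_hom maps_comm)
    also have "\<dots> = eval2 r (\<lambda>x y. h1 x (inv \<alpha>A (\<beta>A y)))"
      by (rule eval_r_invariant[of "\<lambda>x y. h1 x (inv \<alpha>A (\<beta>A y))"])
        (use h in \<open>simp_all add: lin\<close>)
    also have "\<dots> = eval2 r (\<lambda>x y. h1 (\<alpha>A x) (\<beta>A y))"
      using eval_r_shift(3)[of "\<lambda>x y. h1 x (\<beta>A y)"] h by (simp add: lin inv_hom)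
    also have "\<dots> = eval2 r (\<lambda>x y. h1 (inv \<beta>A (\<alpha>A x)) y)"
      using eval_r_shift(2)[of "\<lambda>x y. h1 (\<alpha>A x) y"] h by (simp add: lin inv_hom)
    finally show ?thesis .
  qed
  \<comment> \<open>The inverse of \<alpha> in the first leg becomes \<alpha> in the second, and
    \<beta> in the second becomes its inverse in the first.\<close>
  moreover have "?R1 = eval2 r (\<lambda>x y. h2 (inv \<beta>A x) (\<alpha>A y))"
  proof -
    have "?R1 = eval2 r (\<lambda>x y. h2 (inv \<alpha>A x) (\<beta>A y))"
      by (simp add: h2_def)
    also have "\<dots> = eval2 r (\<lambda>x y. h2 x (\<alpha>A (\<beta>A y)))"
      using eval_r_shift(1)[of "\<lambda>x y. h2 x (\<beta>A y)"] h by (simp add: lin maps_comm)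
    also have "\<dots> = eval2 r (\<lambda>x y. h2 (inv \<beta>A x) (\<alpha>A y))"
      using eval_r_shift(2)[of "\<lambda>x y. h2 x (\<alpha>A y)"] h by (simp add: lin)
    finally show ?thesis .
  qed
  moreover have "?R2 = eval2 r (\<lambda>x y. h3 (inv \<beta>A x) y)"
    using eval_r_shift(2)[OF h(3)] by (simp add: h3_def)
  ultimately show ?thesis by (simp add: algebra_simps)
qed

text \<open>Both sides expand into double sums over \<open>r\<close>, terms linear in \<lambda> and
  a common term in \<lambda> squared. The double sums differ exactly by the \<lambda>-term of
  \<open>act_quasitriangular\<close>.\<close>

lemma coassoc_coact:
  "teq3 sM sA sA
    (sweedler (coact m) (\<lambda>m0 m1. sweedler (\<Delta>\<^sub>r m1) (\<lambda>a1 a2. ten3 (\<omega>M m0) a1 a2)))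
    (sweedler (coact m) (\<lambda>m0 m1. sweedler (coact m0) (\<lambda>n0 n1. ten3 n0 n1 (\<psi>A m1))))"
  unfolding teq3_iff_eval3
proof (intro allI impI)
  fix f assume f: "trilinear_form sM sA sA f"
  note lin = trilinear_form_def bilinear_form_def hom_linear inv_linear eval2_form
  \<comment> \<open>The vector on which \<open>r\<close> acts when the coaction is iterated; the
    identities below normalise the other occurrences to it.\<close>
  define p where "p = \<omega>M (inv \<alpha>M (\<omega>M (inv \<alpha>M m)))"
  have p: "\<omega>M (\<omega>M (inv \<alpha>M m)) = \<alpha>M p" "\<omega>M (\<omega>M (inv \<alpha>M (inv \<alpha>M m))) = p"
    by (simp_all add: p_def inv_hom maps_comm)
  \<comment> \<open>Multiplication by the unit is \<beta> on the left and \<alpha> on the right. By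
    invariance both \<open>r\<close>-terms of \<open>\<Delta>\<^sub>r unit\<close> equal
    \<open>r\<close>, so they cancel.\<close>
  have inv\<beta>: "eval2 r (\<lambda>x y. f (\<omega>M (\<omega>M m)) (\<beta>A x) (\<beta>A y)) = eval2 r (f (\<omega>M (\<omega>M m)))"
    and inv\<alpha>: "eval2 r (\<lambda>x y. f (\<omega>M (\<omega>M m)) (\<alpha>A x) (\<alpha>A y)) = eval2 r (f (\<omega>M (\<omega>M m)))"
    by (rule eval_r_invariant; use f in \<open>simp add: lin\<close>)+
  \<comment> \<open>Removes the \<omega> from the term arising from the unit part of
    \<open>\<Delta>\<^sub>r\<close>, so that it matches the unit part of the outer coaction on the
    other side.\<close>
  have inv\<omega>: "eval2 r (\<lambda>x y. f (act (\<alpha>M p) (\<omega>A x)) (\<beta>A (\<omega>A y)) unit)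
      = eval2 r (\<lambda>x y. f (act (\<alpha>M p) x) (\<beta>A y) unit)"
    by (rule eval_r_invariant[of "\<lambda>x y. f (act (\<alpha>M p) x) (\<beta>A y) unit"])
      (use f in \<open>simp_all add: lin\<close>)
  have "eval3 (sweedler (coact m) (\<lambda>m0 m1. sweedler (\<Delta>\<^sub>r m1) (\<lambda>a1 a2. ten3 (\<omega>M m0) a1 a2))) f
    = eval2 r (\<lambda>x y. eval2 r (\<lambda>x' y'.
        f (act (\<alpha>M p) (\<omega>A x)) (mult (\<omega>A (inv \<alpha>A (\<beta>A y))) x') (\<beta>A y')))
    - eval2 r (\<lambda>x y. eval2 r (\<lambda>x' y'. f (act (\<alpha>M p) (\<omega>A x)) (\<alpha>A x') (mult y' (\<psi>A y))))
    - lam * eval2 r (\<lambda>x y. f (act (\<alpha>M p) x) (\<beta>A y) unit)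
    + lam * lam * f (\<omega>M (\<omega>M m)) unit unit"
    by (simp add: \<omega>M_act p eval2_form inv_hom(9,10) \<omega>_unit \<psi>_unit unit_mult mult_unit inv\<beta> inv\<alpha>
        maps_comm(5) inv\<omega> algebra_simps)
  also have "\<dots> = eval2 r (\<lambda>x y. eval2 r (\<lambda>x' y'.
        f (act (act p (\<omega>A (inv \<alpha>A x))) x') (\<beta>A y') (\<psi>A (\<beta>A y))))
    - lam * eval2 r (\<lambda>x y. f (act (\<alpha>M p) (\<omega>A x)) unit (\<psi>A (\<beta>A y)))
    - lam * eval2 r (\<lambda>x y. f (act (\<alpha>M p) x) (\<beta>A y) unit)
    + lam * lam * f (\<omega>M (\<omega>M m)) unit unit"
    using act_quasitriangular[OF f, of p] by simp
  also have "\<dots> = eval3 (sweedler (coact m)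
      (\<lambda>m0 m1. sweedler (coact m0) (\<lambda>n0 n1. ten3 n0 n1 (\<psi>A m1)))) f"
    by (simp add: eval2_form \<omega>M_act inv_hom(3) \<psi>_unit p inv_hom(1) algebra_simps)
  finally show "eval3 (sweedler (coact m) (\<lambda>m0 m1. sweedler (\<Delta>\<^sub>r m1) (\<lambda>a1 a2. ten3 (\<omega>M m0) a1 a2))) f
    = eval3 (sweedler (coact m) (\<lambda>m0 m1. sweedler (coact m0) (\<lambda>n0 n1. ten3 n0 n1 (\<psi>A m1)))) f" .
qed

theorem Hopf_module_coact:
  "right_infBH_Hopf_module lam sA mult \<Delta>\<^sub>r \<alpha>A \<beta>A \<psi>A \<omega>A sM act coact \<alpha>M \<beta>M \<psi>M \<omega>M"
proof (intro right_infBH_Hopf_module.intro right_bihom_comodule.intro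
    right_infBH_Hopf_module_axioms.intro)
  show "f \<circ> g = g \<circ> f" if "f \<in> {\<alpha>M, \<beta>M, \<psi>M, \<omega>M}" "g \<in> {\<alpha>M, \<beta>M, \<psi>M, \<omega>M}" for f g
    using that \<alpha>M_\<beta>M \<alpha>M_\<omega>M \<beta>M_\<omega>M \<alpha>M_\<psi>M \<beta>M_\<psi>M \<omega>M_\<psi>M by auto
qed (fact right_bihom_module_axioms linear_to_tensor_comult linear_to_tensor_coact
  \<psi>_linear \<omega>_linear \<psi>M_linear \<omega>M_linear \<omega>M_\<psi>M[symmetric] psi_colinear omega_colinear
  coassoc_coact Hopf_compatible_coact)+

end

theorem theorem2p44:
  fixes lam :: "'k::field"
    and sA :: "'k \<Rightarrow> 'a::ab_group_add \<Rightarrow> 'a"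
    and mult :: "'a \<Rightarrow> 'a \<Rightarrow> 'a"
    and unit :: 'a
    and \<alpha>A \<beta>A \<psi>A \<omega>A :: "'a \<Rightarrow> 'a"
    and r :: "'a \<times> 'a \<Rightarrow>\<^sub>0 'k"
    and sM :: "'k \<Rightarrow> 'm::ab_group_add \<Rightarrow> 'm"
    and act :: "'m \<Rightarrow> 'a \<Rightarrow> 'm"
    and \<alpha>M \<beta>M \<psi>M \<omega>M :: "'m \<Rightarrow> 'm"
  assumes "quasitriangular_infBH_bialgebra lam sA mult unit \<alpha>A \<beta>A \<psi>A \<omega>A r"
    and "right_bihom_module sA mult \<alpha>A \<beta>A sM act \<alpha>M \<beta>M"
    and "bij \<alpha>M"
    and "Vector_Spaces.linear sM sM \<psi>M"
    and "Vector_Spaces.linear sM sM \<omega>M"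
    and "\<alpha>M \<circ> \<omega>M = \<omega>M \<circ> \<alpha>M"
    and "\<And>m a. \<omega>M (act m a) = act (\<omega>M m) (\<omega>A a)"
    \<comment> \<open>The remaining hypotheses are left implicit in the informal statement, which fails
      without them: the hypotheses above say nothing about \<open>\<psi>M\<close> beyond linearity, nor about
      \<open>\<beta>M \<circ> \<omega>M\<close>, while the conclusion requires commutation and \<open>\<psi>\<close>-colinearity.\<close>
    and "\<beta>M \<circ> \<omega>M = \<omega>M \<circ> \<beta>M"
    and "\<alpha>M \<circ> \<psi>M = \<psi>M \<circ> \<alpha>M"
    and "\<beta>M \<circ> \<psi>M = \<psi>M \<circ> \<beta>M"
    and "\<omega>M \<circ> \<psi>M = \<psi>M \<circ> \<omega>M"
    and "\<And>m a. \<psi>M (act m a) = act (\<psi>M m) (\<psi>A a)"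
  shows "right_infBH_Hopf_module lam sA mult (qt_comult lam mult unit \<alpha>A \<beta>A \<psi>A \<omega>A r)
    \<alpha>A \<beta>A \<psi>A \<omega>A sM act
    (\<lambda>m. sweedler r (\<lambda>r1 r2. ten2 (act (\<omega>M (inv \<alpha>M m)) r1) (\<beta>A r2)) - lam \<bullet> ten2 (\<omega>M m) unit)
    \<alpha>M \<beta>M \<psi>M \<omega>M"
proof -
  interpret qm: quasitriangular_module lam sA mult unit \<alpha>A \<beta>A \<psi>A \<omega>A r sM act \<alpha>M \<beta>M \<psi>M \<omega>M
    using assms by (simp add: quasitriangular_module_def quasitriangular_module_axioms_def)
  show ?thesis
    using qm.Hopf_module_coact unfolding qm.coact_def .
qed

end
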